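(* Let $G$ be a finite non-abelian group with center $Z(G)$, and let $\Gamma_G$ be its commuting conjugacy class graph. Then $\Gamma_G$ is both CNL-integral and CNSL-integral if any one of the following holds: (1) $G/Z(G) \cong \mathbb{Z}_p \times \mathbb{Z}_p$ for some prime $p$; (2) $G/Z(G) \cong D_{2n}$ for some $n \ge 3$; (3) $G$ is isomorphic to one of $D_{2n}$ ($n \ge 3$), $T_{4n}$ ($n \ge 2$), $U_{6n}$ ($n\ge 2$), $U_{(n,m)}$ ($n \ge 2$, $m \ge 2$), $SD_{8n}$ ($n \ge 2$), $V_{8n}$ ($n \ge 2$).
   Context: For a finite non-abelian group $G$ with center $Z(G)$, the commuting conjugacy class graph (CCC-graph) $\Gamma_G$ is the simple undirected graph whose vertices are the conjugacy classes $x^G$ of non-central elements $x \in G \setminus Z(G)$; two distinct vertices $x^G, y^G$ are adjacent if there exist $x' \in x^G$ and $y' \in y^G$ with $x'y' = y'x'$. For a finite simple graph $\mathcal{G}$ with vertices $v_1,\dots,v_N$, let $CN(\mathcal{G})$ be the $N\times N$ matrix whose $(i,j)$ entry is, for $i\ne j$, the number of vertices other than $v_i,v_j$ adjacent to both $v_i$ and $v_j$, and whose diagonal entries are $0$. Let $CNRS(\mathcal{G})$ be the diagonal matrix whose $i$-th diagonal entry is the $i$-th row sum of $CN(\mathcal{G})$. Put $CNL(\mathcal{G}) = CNRS(\mathcal{G}) - CN(\mathcal{G})$ and $CNSL(\mathcal{G}) = CNRS(\mathcal{G}) + CN(\mathcal{G})$. The graph $\mathcal{G}$ is CNL-integral (respectively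 CNSL-integral) if all eigenvalues of $CNL(\mathcal{G})$ (respectively $CNSL(\mathcal{G})$) are integers. Groups: $D_{2n}=\langle x,y : x^n=y^2=1,\ yxy^{-1}=x^{-1}\rangle$; $T_{4n}=\langle x,y : x^{2n}=1,\ x^n=y^2,\ y^{-1}xy=x^{-1}\rangle$; $U_{6n}=\langle x,y : x^{2n}=y^3=1,\ x^{-1}yx=y^{-1}\rangle$; $U_{(n,m)}=\langle x,y : x^{2n}=y^m=1,\ x^{-1}yx=y^{-1}\rangle$; $SD_{8n}=\langle x,y : x^{4n}=y^2=1,\ yxy=x^{2n-1}\rangle$; $V_{8n}=\langle x,y : x^{2n}=y^4=1,\ yx=x^{-1}y^{-1},\ y^{-1}x=x^{-1}y\rangle$. *)

theory Defs
  imports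
    Complex_Main
    "HOL-Algebra.Elementary_Groups"
    "Graph_Theory.Pair_Digraph"
    "Jordan_Normal_Form.Char_Poly"
begin

section \<open>The commuting conjugacy class graph\<close>

definition group_center :: "('a, 'b) monoid_scheme \<Rightarrow> 'a set" where
  "group_center G = {z \<in> carrier G. \<forall>g\<in>carrier G. g \<otimes>\<^bsub>G\<^esub> z = z \<otimes>\<^bsub>G\<^esub> g}"

definition conj_class :: "('a, 'b) monoid_scheme \<Rightarrow> 'a \<Rightarrow> 'a set" where
  "conj_class G x = {g \<otimes>\<^bsub>G\<^esub> x \<otimes>\<^bsub>G\<^esub> inv\<^bsub>G\<^esub> g | g. g \<in> carrier G}"

text \<open>An undirected edge is represented by the two arcs between its endpoints; on a finite group the
  result is a simple graph in the sense of the locale \<^locale>\<open>pair_graph\<close>, see below.\<close>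

definition ccc_graph :: "('a, 'b) monoid_scheme \<Rightarrow> 'a set pair_pre_digraph" where
  "ccc_graph G =
     (let V = conj_class G ` (carrier G - group_center G) in
      \<lparr> pverts = V,
        parcs = {(A, B). A \<in> V \<and> B \<in> V \<and> A \<noteq> B \<and>
                   (\<exists>x'\<in>A. \<exists>y'\<in>B. x' \<otimes>\<^bsub>G\<^esub> y' = y' \<otimes>\<^bsub>G\<^esub> x')} \<rparr>)"

lemma pair_graph_ccc_graph:
  assumes "finite (carrier G)"
  shows "pair_graph (ccc_graph G)"
proof -
  let ?V = "conj_class G ` (carrier G - group_center G)"
  have "parcs (ccc_graph G) \<subseteq> ?V \<times> ?V"
    by (auto simp: ccc_graph_def Let_def)
  moreover have "finite (?V \<times> ?V)"
    using assms by auto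
  ultimately have "finite (parcs (ccc_graph G))"
    by (rule finite_subset)
  moreover have "sym (parcs (ccc_graph G))"
    unfolding ccc_graph_def Let_def by (rule symI) (simp, metis)
  then have "Digraph.symmetric (with_proj (ccc_graph G))"
    by (simp add: Digraph.symmetric_def)
  ultimately show ?thesis
    using assms by unfold_locales (auto simp: ccc_graph_def Let_def)
qed


section \<open>Common neighbourhood (signless) Laplacian\<close>

text \<open>The matrices are taken with respect to an enumeration \<open>vs\<close> of the vertices. Their entries are
  integers; complex entries let the eigenvalues range over \<open>\<complex>\<close>.\<close>

definition CN_mat :: "'v pair_pre_digraph \<Rightarrow> 'v list \<Rightarrow> complex mat" where
  "CN_mat \<G> vs = mat (length vs) (length vs) (\<lambda>(i, j).
     if i = j then 0
     else of_nat (card {w \<in> pverts \<G>. w \<noteq> vs ! i \<and> w \<noteq> vs ! j \<and>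
                          (w, vs ! i) \<in> parcs \<G> \<and> (w, vs ! j) \<in> parcs \<G>}))"

definition CNRS_mat :: "'v pair_pre_digraph \<Rightarrow> 'v list \<Rightarrow> complex mat" where
  "CNRS_mat \<G> vs = mat (length vs) (length vs) (\<lambda>(i, j).
     if i = j then (\<Sum>k<length vs. CN_mat \<G> vs $$ (i, k)) else 0)"

definition CNL_mat :: "'v pair_pre_digraph \<Rightarrow> 'v list \<Rightarrow> complex mat" where
  "CNL_mat \<G> vs = CNRS_mat \<G> vs - CN_mat \<G> vs"

definition CNSL_mat :: "'v pair_pre_digraph \<Rightarrow> 'v list \<Rightarrow> complex mat" where
  "CNSL_mat \<G> vs = CNRS_mat \<G> vs + CN_mat \<G> vs"

text \<open>The spectrum does not depend on the enumeration, so quantifying over all enumerations is the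
  same as choosing one (there is one as soon as the graph is finite).\<close>

definition CNL_integral :: "'v pair_pre_digraph \<Rightarrow> bool" where
  "CNL_integral \<G> \<longleftrightarrow>
     (\<forall>vs. distinct vs \<and> set vs = pverts \<G> \<longrightarrow>
        (\<forall>k. eigenvalue (CNL_mat \<G> vs) k \<longrightarrow> k \<in> \<int>))"

definition CNSL_integral :: "'v pair_pre_digraph \<Rightarrow> bool" where
  "CNSL_integral \<G> \<longleftrightarrow>
     (\<forall>vs. distinct vs \<and> set vs = pverts \<G> \<longrightarrow>
        (\<forall>k. eigenvalue (CNSL_mat \<G> vs) k \<longrightarrow> k \<in> \<int>))"


section \<open>Groups given by generators and relations\<close>

text \<open>The generators are all elements of the type \<open>'g\<close>. A pair \<open>(u, v)\<close> in \<open>R\<close> stands for the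
  relation \<open>u = v\<close>. The presented group consists of the words in the generators and their formal
  inverses modulo the least congruence that contains \<open>R\<close> and cancels inverse letters, which
  is the free group modulo the normal closure of the words \<open>u v\<^sup>-\<^sup>1\<close>.\<close>

datatype 'g letter = Gen 'g | Inv 'g

inductive word_eq :: "('g letter list \<times> 'g letter list) set \<Rightarrow> 'g letter list \<Rightarrow> 'g letter list \<Rightarrow> bool"
  for R where
    rel: "(u, v) \<in> R \<Longrightarrow> word_eq R u v"
  | gen_inv: "word_eq R [Gen g, Inv g] []"
  | inv_gen: "word_eq R [Inv g, Gen g] []"
  | refl: "word_eq R u u"
  | sym: "word_eq R u v \<Longrightarrow> word_eq R v u"
  | trans: "word_eq R u v \<Longrightarrow> word_eq R v w \<Longrightarrow> word_eq R u w"
  | cong: "word_eq R u u' \<Longrightarrow> word_eq R v v' \<Longrightarrow> word_eq R (u @ v) (u' @ v')"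

definition word_class :: "('g letter list \<times> 'g letter list) set \<Rightarrow> 'g letter list \<Rightarrow> 'g letter list set" where
  "word_class R u = {v. word_eq R u v}"

definition presented_group :: "('g letter list \<times> 'g letter list) set \<Rightarrow> 'g letter list set monoid" where
  "presented_group R =
     \<lparr> carrier = range (word_class R),
       monoid.mult = (\<lambda>A B. \<Union>u\<in>A. \<Union>v\<in>B. word_class R (u @ v)),
       one = word_class R [] \<rparr>"

lemma word_class_eq_iff: "word_class R u = word_class R v \<longleftrightarrow> word_eq R u v"
proof
  assume "word_class R u = word_class R v"
  moreover have "v \<in> word_class R v" by (simp add: word_class_def word_eq.refl)
  ultimately show "word_eq R u v" by (auto simp: word_class_def)
next
  assume "word_eq R u v"
  then show "word_class R u = word_class R v"
    unfolding word_class_def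
    by (intro Collect_cong iffI) (erule (1) word_eq.trans[OF word_eq.sym] word_eq.trans)+
qed

lemma presented_group_mult:
  "word_class R u \<otimes>\<^bsub>presented_group R\<^esub> word_class R v = word_class R (u @ v)"
proof -
  have "word_class R (u' @ v') = word_class R (u @ v)"
    if "u' \<in> word_class R u" "v' \<in> word_class R v" for u' v'
  proof -
    have "word_eq R u u'" "word_eq R v v'"
      using that by (simp_all add: word_class_def)
    then show ?thesis
      unfolding word_class_eq_iff by (intro word_eq.sym[OF word_eq.cong])
  qed
  then have "(\<Union>u'\<in>word_class R u. \<Union>v'\<in>word_class R v. word_class R (u' @ v'))
      = (\<Union>u'\<in>word_class R u. \<Union>v'\<in>word_class R v. word_class R (u @ v))"
    by (intro SUP_cong HOL.refl)
  moreover have "u \<in> word_class R u" "v \<in> word_class R v"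
    by (simp_all add: word_class_def word_eq.refl)
  then have "word_class R u \<noteq> {}" "word_class R v \<noteq> {}"
    by blast+
  ultimately show ?thesis
    by (simp add: presented_group_def)
qed

lemma word_left_inverse: "\<exists>v. word_eq R (v @ u) []"
proof (induction u)
  case Nil
  have "word_eq R ([] @ []) []" by (simp add: word_eq.refl)
  then show ?case by blast
next
  case (Cons a u)
  then obtain v where v: "word_eq R (v @ u) []" by blast
  obtain b where b: "word_eq R [b, a] []"
    by (cases a) (blast intro: word_eq.gen_inv word_eq.inv_gen)+
  have "word_eq R (v @ ([b, a] @ u)) (v @ ([] @ u))"
    by (intro word_eq.cong word_eq.refl b)
  then have "word_eq R ((v @ [b]) @ (a # u)) []"
    using word_eq.trans[OF _ v] by simp
  then show ?case by blast
qed

lemma group_presented_group: "group (presented_group R)"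
proof (rule groupI)
  fix A assume "A \<in> carrier (presented_group R)"
  then obtain u where u: "A = word_class R u" by (auto simp: presented_group_def)
  obtain v where "word_eq R (v @ u) []" using word_left_inverse by blast
  then have "word_class R v \<otimes>\<^bsub>presented_group R\<^esub> A = \<one>\<^bsub>presented_group R\<^esub>"
    by (simp add: u presented_group_mult word_class_eq_iff) (simp add: presented_group_def word_class_eq_iff)
  then show "\<exists>B\<in>carrier (presented_group R). B \<otimes>\<^bsub>presented_group R\<^esub> A = \<one>\<^bsub>presented_group R\<^esub>"
    by (auto simp: presented_group_def)
next
  have c: "carrier (presented_group R) = range (word_class R)"
    and o: "\<one>\<^bsub>presented_group R\<^esub> = word_class R []"
    by (simp_all add: presented_group_def)
  fix A B C
  show "\<one>\<^bsub>presented_group R\<^esub> \<in> carrier (presented_group R)"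
    by (simp add: c o)
  assume "A \<in> carrier (presented_group R)"
  then obtain u where u: "A = word_class R u" by (auto simp: c)
  show "\<one>\<^bsub>presented_group R\<^esub> \<otimes>\<^bsub>presented_group R\<^esub> A = A"
    by (simp add: o u presented_group_mult)
  assume "B \<in> carrier (presented_group R)"
  then obtain v where v: "B = word_class R v" by (auto simp: c)
  show "A \<otimes>\<^bsub>presented_group R\<^esub> B \<in> carrier (presented_group R)"
    by (simp add: c u v presented_group_mult)
  assume "C \<in> carrier (presented_group R)"
  then obtain w where w: "C = word_class R w" by (auto simp: c)
  show "A \<otimes>\<^bsub>presented_group R\<^esub> B \<otimes>\<^bsub>presented_group R\<^esub> C
      = A \<otimes>\<^bsub>presented_group R\<^esub> (B \<otimes>\<^bsub>presented_group R\<^esub> C)"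
    by (simp add: u v w presented_group_mult)
qed


section \<open>The families of groups\<close>

datatype xy = X | Y

definition D2n :: "nat \<Rightarrow> xy letter list set monoid" where
  "D2n n = presented_group
     {(replicate n (Gen X), []),
      (replicate 2 (Gen Y), []),
      ([Gen Y, Gen X, Inv Y], [Inv X])}"

definition T4n :: "nat \<Rightarrow> xy letter list set monoid" where
  "T4n n = presented_group
     {(replicate (2 * n) (Gen X), []),
      (replicate n (Gen X), replicate 2 (Gen Y)),
      ([Inv Y, Gen X, Gen Y], [Inv X])}"

definition U6n :: "nat \<Rightarrow> xy letter list set monoid" where
  "U6n n = presented_group
     {(replicate (2 * n) (Gen X), []),
      (replicate 3 (Gen Y), []),
      ([Inv X, Gen Y, Gen X], [Inv Y])}"

definition Unm :: "nat \<Rightarrow> nat \<Rightarrow> xy letter list set monoid" where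
  "Unm n m = presented_group
     {(replicate (2 * n) (Gen X), []),
      (replicate m (Gen Y), []),
      ([Inv X, Gen Y, Gen X], [Inv Y])}"

definition SD8n :: "nat \<Rightarrow> xy letter list set monoid" where
  "SD8n n = presented_group
     {(replicate (4 * n) (Gen X), []),
      (replicate 2 (Gen Y), []),
      ([Gen Y, Gen X, Gen Y], replicate (2 * n - 1) (Gen X))}"

definition V8n :: "nat \<Rightarrow> xy letter list set monoid" where
  "V8n n = presented_group
     {(replicate (2 * n) (Gen X), []),
      (replicate 4 (Gen Y), []),
      ([Gen Y, Gen X], [Inv X, Inv Y]),
      ([Inv Y, Gen X], [Inv X, Gen Y])}"

end

theory Submission
  imports Defs
begin

text \<open>In each case commuting is a transitive relation on the non-central elements of \<open>G\<close>. If the quotient by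
  the centre has order \<open>p\<^sup>2\<close>, there is no room for a subgroup strictly between the centre and the
  centralizer of a non-central element. In all other cases \<open>G\<close> has an abelian subgroup \<open>A\<close> of index at
  most \<open>2\<close>: an element outside \<open>A\<close> commutes only with central elements and its own central multiples,
  and a non-central element of \<open>A\<close> commutes only with \<open>A\<close>. By conjugating a commuting pair, transitivity
  passes to conjugacy classes, so the graph is a disjoint union of complete graphs. On a component with
  \<open>m\<close> vertices the common neighbourhood matrix is \<open>m - 2\<close> times the adjacency matrix, so both
  Laplacians are block matrices with integer entries, constant on the diagonal and off the diagonal of
  each block.\<close>

subsection \<open>Disjoint unions of complete graphs\<close>

text \<open>Row \<open>i\<close> of the eigenvalue equation involves only \<open>v $ i\<close> and
  the sum \<open>S i\<close> of \<open>v\<close> over the class of \<open>i\<close>. At an index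
  with \<open>v $ i \<noteq> 0\<close>, either \<open>S i = 0\<close> and then
  \<open>k = a i - b i\<close>, or summing the rows of the class and cancelling \<open>S i\<close>
  gives \<open>k = a i - b i + card (K i) * b i\<close>.\<close>

lemma eigenvalue_block_mat_Ints:
  fixes a b :: "nat \<Rightarrow> complex"
  assumes refl: "\<And>i. i < n \<Longrightarrow> r i i"
    and sym: "\<And>i j. i < n \<Longrightarrow> j < n \<Longrightarrow> r i j \<Longrightarrow> r j i"
    and trans: "\<And>i j k. i < n \<Longrightarrow> j < n \<Longrightarrow> k < n \<Longrightarrow> r i j \<Longrightarrow> r j k \<Longrightarrow> r i k"
    and Ints: "\<And>i. i < n \<Longrightarrow> a i \<in> \<int>" "\<And>i. i < n \<Longrightarrow> b i \<in> \<int>"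
    and const: "\<And>i j. i < n \<Longrightarrow> j < n \<Longrightarrow> r i j \<Longrightarrow> a i = a j"
      "\<And>i j. i < n \<Longrightarrow> j < n \<Longrightarrow> r i j \<Longrightarrow> b i = b j"
    and k: "eigenvalue (mat n n (\<lambda>(i, j). if i = j then a i else if r i j then b i else 0)) k"
  shows "k \<in> \<int>"
proof -
  define M where "M = mat n n (\<lambda>(i, j). if i = j then a i else if r i j then b i else 0)"
  define K where "K i = {j. j < n \<and> r i j}" for i
  obtain v where v: "v \<in> carrier_vec n" "v \<noteq> 0\<^sub>v n" "M *\<^sub>v v = k \<cdot>\<^sub>v v"
    using k by (auto simp: eigenvalue_def eigenvector_def M_def)
  define S where "S i = (\<Sum>j\<in>K i. v $ j)" for i
  have row: "k * v $ i = (a i - b i) * v $ i + b i * S i" if i: "i < n" for i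
  proof -
    have "k * v $ i = (M *\<^sub>v v) $ i"
      using v i by simp
    also have "\<dots> = (\<Sum>j\<in>{0..<n}. M $$ (i, j) * v $ j)"
      using i v(1) by (simp add: M_def scalar_prod_def)
    \<comment> \<open>The diagonal entry is split as \<open>(a i - b i) + b i\<close>, so that its
      second part completes the sum over the whole class.\<close>
    also have "\<dots> = (\<Sum>j\<in>{0..<n}. (if j = i then (a i - b i) * v $ i else 0)
        + (if j \<in> K i then b i * v $ j else 0))"
      using i refl[OF i] by (intro sum.cong) (auto simp: M_def K_def algebra_simps)
    also have "\<dots> = (a i - b i) * v $ i + (\<Sum>j\<in>{0..<n}. if j \<in> K i then b i * v $ j else 0)"
      using i by (simp add: sum.distrib)
    also have "(\<Sum>j\<in>{0..<n}. if j \<in> K i then b i * v $ j else 0) = (\<Sum>j\<in>K i. b i * v $ j)"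
      by (subst sum.inter_restrict[symmetric]) (auto simp: K_def intro: sum.cong)
    finally show ?thesis
      by (simp add: S_def sum_distrib_left)
  qed
  obtain i where i: "i < n" "v $ i \<noteq> 0"
    using v(1,2) by (metis carrier_vecD eq_vecI index_zero_vec)
  show ?thesis
  proof (cases "S i = 0")
    case True
    then have "k = a i - b i"
      using row[OF i(1)] i(2) by simp
    then show ?thesis
      using Ints i(1) by simp
  next
    case False
    have "k * S i = (\<Sum>j\<in>K i. k * v $ j)"
      by (simp add: S_def sum_distrib_left)
    also have "\<dots> = (\<Sum>j\<in>K i. (a i - b i) * v $ j + b i * S i)"
    proof (rule sum.cong)
      fix j assume "j \<in> K i"
      then have j: "j < n" "r i j"
        by (simp_all add: K_def)
      have "K j = K i"
        unfolding K_def using trans[OF i(1) j(1)] trans[OF j(1) i(1)] j sym[OF i(1) j] by blast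
      then have "S j = S i"
        by (simp add: S_def)
      moreover have "a j = a i" "b j = b i"
        using const[OF i(1) j] by simp_all
      ultimately show "k * v $ j = (a i - b i) * v $ j + b i * S i"
        using row[OF j(1)] by simp
    qed simp
    also have "\<dots> = (a i - b i + of_nat (card (K i)) * b i) * S i"
      by (simp add: sum.distrib S_def flip: sum_distrib_left) (simp add: algebra_simps)
    finally have "k = a i - b i + of_nat (card (K i)) * b i"
      using False by simp
    then show ?thesis
      using Ints i(1) by simp
  qed
qed

text \<open>The factor \<open>e\<close> treats both Laplacians at once: \<open>-1\<close> gives
  \<open>CNL_mat\<close> and \<open>1\<close> gives \<open>CNSL_mat\<close>. Transitive adjacency
  makes equality-or-adjacency an equivalence relation with complete subgraphs as classes. Distinct
  vertices of one class have all its other members as common neighbours; vertices of different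
  classes have none.\<close>

lemma (in pair_graph) CNRS_add_mult_CN_eigenvalue_Ints:
  assumes adj_trans: "\<And>u v w. (u, v) \<in> parcs G \<Longrightarrow> (v, w) \<in> parcs G \<Longrightarrow> u \<noteq> w \<Longrightarrow> (u, w) \<in> parcs G"
    and vs: "distinct vs" "set vs = pverts G"
    and e: "e \<in> \<int>"
    and k: "eigenvalue (CNRS_mat G vs + e \<cdot>\<^sub>m CN_mat G vs) k"
  shows "k \<in> \<int>"
proof -
  define n where "n = length vs"
  define cls where "cls u = {w \<in> pverts G. w = u \<or> (w, u) \<in> parcs G}" for u
  define r where "r i j \<longleftrightarrow> vs ! i = vs ! j \<or> (vs ! i, vs ! j) \<in> parcs G" for i j
  \<comment> \<open>Truncated subtraction makes \<open>b\<close> zero on a singleton class, where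
    there is no off-diagonal entry to describe.\<close>
  define b :: "nat \<Rightarrow> complex" where "b i = of_nat (card (cls (vs ! i)) - 2)" for i
  define a where "a i = (\<Sum>j<n. CN_mat G vs $$ (i, j))" for i
  have adj_sym: "(v, u) \<in> parcs G" if "(u, v) \<in> parcs G" for u v
    using that by (rule arcs_symmetric)
  have irr: "(u, u) \<notin> parcs G" for u
    using no_loops' by blast
  have wf: "v \<in> pverts G" if "(u, v) \<in> parcs G" for u v
    using that by (rule in_arcsD2)
  have r_trans: "r i l" if "r i j" "r j l" for i j l
    using that adj_trans[of "vs ! i" "vs ! j" "vs ! l"] by (cases "vs ! i = vs ! l") (auto simp: r_def)
  have r_sym: "r j i" if "r i j" for i j
    using that adj_sym by (auto simp: r_def)
  have mem: "vs ! i \<in> pverts G" if "i < n" for i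
    using nth_mem[OF that[unfolded n_def]] unfolding vs(2) .
  have cls_eq: "cls (vs ! i) = cls (vs ! j)" if ij: "r i j" for i j
  proof -
    have "cls u \<subseteq> cls v" if "u = v \<or> (u, v) \<in> parcs G" for u v
      using that adj_trans[of _ u v] wf by (auto simp: cls_def)
    then show ?thesis
      using ij r_sym[OF ij] unfolding r_def by blast
  qed
  have CN: "CN_mat G vs $$ (i, j) = (if i = j then 0 else if r i j then b i else 0)"
    if ij: "i < n" "j < n" for i j
  proof (cases "i = j")
    case True
    with ij show ?thesis by (simp add: CN_mat_def n_def)
  next
    case False
    then have ne: "vs ! i \<noteq> vs ! j"
      using ij vs(1) by (simp add: n_def nth_eq_iff_index_eq)
    let ?N = "{w \<in> pverts G. w \<noteq> vs ! i \<and> w \<noteq> vs ! j \<and> (w, vs ! i) \<in> parcs G \<and> (w, vs ! j) \<in> parcs G}"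
    have "card ?N = (if r i j then card (cls (vs ! i)) - 2 else 0)"
    proof (cases "r i j")
      case True
      then have arc: "(vs ! i, vs ! j) \<in> parcs G"
        using ne by (simp add: r_def)
      have "?N = cls (vs ! i) - {vs ! i, vs ! j}"
        using adj_trans[OF _ arc] by (auto simp: cls_def)
      moreover have "{vs ! i, vs ! j} \<subseteq> cls (vs ! i)"
        using adj_sym[OF arc] mem[OF ij(1)] mem[OF ij(2)] by (auto simp: cls_def)
      ultimately show ?thesis
        using True ne by (simp add: card_Diff_subset)
    next
      case False
      \<comment> \<open>A common neighbour would join the two vertices by transitivity.\<close>
      then have "?N = {}"
        using ne adj_trans[OF adj_sym] unfolding r_def by blast
      with False show ?thesis by simp
    qed
    with False ij show ?thesis by (simp add: CN_mat_def n_def b_def)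
  qed
  have b_eq: "b i = b j" if "r i j" for i j
    using cls_eq[OF that] by (simp add: b_def)
  \<comment> \<open>The row carries \<open>b i\<close> at every other index of the class and zero
    elsewhere. This form shows that the row sum is an integer and constant on classes.\<close>
  have a_eq_card: "a i = of_nat (card ({j. j < n \<and> r i j} - {i})) * b i" if i: "i < n" for i
  proof -
    have "a i = (\<Sum>j<n. if j \<in> {j. j < n \<and> r i j} - {i} then b i else 0)"
      using i by (auto simp: a_def CN intro!: sum.cong)
    also have "\<dots> = (\<Sum>j\<in>{j. j < n \<and> r i j} - {i}. b i)"
      by (intro sum.mono_neutral_cong_right) auto
    finally show ?thesis by simp
  qed
  have a_eq: "a i = a j" if "i < n" "j < n" "r i j" for i j
  proof -
    have "{l. l < n \<and> r i l} = {l. l < n \<and> r j l}"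
      using that(3) r_trans r_sym by blast
    moreover have "i \<in> {l. l < n \<and> r i l}" "j \<in> {l. l < n \<and> r j l}"
      using that by (auto simp: r_def)
    ultimately show ?thesis
      using that(1,2) b_eq[OF that(3)] by (simp add: a_eq_card card_Diff_singleton_if)
  qed
  have Ints: "a i \<in> \<int>" "e * b i \<in> \<int>" if "i < n" for i
    using e by (auto simp: a_eq_card[OF that] b_def)
  have "CNRS_mat G vs + e \<cdot>\<^sub>m CN_mat G vs =
      mat n n (\<lambda>(i, j). if i = j then a i else if r i j then e * b i else 0)"
    (is "?L = _")
  proof (rule eq_matI)
    fix i j assume "i < dim_row (mat n n (\<lambda>(i, j). if i = j then a i else if r i j then e * b i else 0))"
      and "j < dim_col (mat n n (\<lambda>(i, j). if i = j then a i else if r i j then e * b i else 0))"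
    then have ij: "i < n" "j < n" by simp_all
    have dim: "i < dim_row (CN_mat G vs)" "j < dim_col (CN_mat G vs)"
      using ij by (simp_all add: CN_mat_def n_def)
    show "?L $$ (i, j) = mat n n (\<lambda>(i, j). if i = j then a i else if r i j then e * b i else 0) $$ (i, j)"
      using ij dim CN[OF ij] by (simp add: CNRS_mat_def a_def flip: n_def)
  qed (simp_all add: CN_mat_def CNRS_mat_def n_def)
  then have "eigenvalue (mat n n (\<lambda>(i, j). if i = j then a i else if r i j then e * b i else 0)) k"
    using k by simp
  then show ?thesis
  proof (rule eigenvalue_block_mat_Ints[rotated -1])
    show "r i i" for i by (simp add: r_def)
    show "r j i" if "r i j" for i j using that by (rule r_sym)
    show "r i l" if "r i j" "r j l" for i j l using that by (rule r_trans)
    show "e * b i = e * b j" if "r i j" for i j using b_eq[OF that] by simp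
  qed (fact Ints a_eq)+
qed

lemma (in pair_graph) CNL_CNSL_integral:
  assumes "\<And>u v w. (u, v) \<in> parcs G \<Longrightarrow> (v, w) \<in> parcs G \<Longrightarrow> u \<noteq> w \<Longrightarrow> (u, w) \<in> parcs G"
  shows "CNL_integral G \<and> CNSL_integral G"
proof -
  note * = CNRS_add_mult_CN_eigenvalue_Ints[OF assms]
  have "CNL_mat G vs = CNRS_mat G vs + (-1) \<cdot>\<^sub>m CN_mat G vs" for vs
    by (rule eq_matI) (simp_all add: CNL_mat_def CNRS_mat_def CN_mat_def)
  moreover have "CNSL_mat G vs = CNRS_mat G vs + 1 \<cdot>\<^sub>m CN_mat G vs" for vs
    by (rule eq_matI) (simp_all add: CNSL_mat_def CNRS_mat_def CN_mat_def)
  ultimately show ?thesis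
    unfolding CNL_integral_def CNSL_integral_def
    using *[where e = "-1"] *[where e = 1] by auto
qed

subsection \<open>Groups in which commuting is transitive\<close>

definition centralizer :: "('a, 'b) monoid_scheme \<Rightarrow> 'a set \<Rightarrow> 'a set" where
  "centralizer G S = {g \<in> carrier G. \<forall>s\<in>S. g \<otimes>\<^bsub>G\<^esub> s = s \<otimes>\<^bsub>G\<^esub> g}"

text \<open>Central elements are left out because they commute with everything and would link
  arbitrary elements. These are the groups in which every non-central element has an abelian
  centralizer, often called AC-groups.\<close>

definition commuting_transitive :: "('a, 'b) monoid_scheme \<Rightarrow> bool" where
  "commuting_transitive G \<longleftrightarrow>
     (\<forall>x\<in>carrier G - group_center G. \<forall>y\<in>carrier G - group_center G. \<forall>z\<in>carrier G - group_center G.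
        x \<otimes>\<^bsub>G\<^esub> y = y \<otimes>\<^bsub>G\<^esub> x \<longrightarrow> y \<otimes>\<^bsub>G\<^esub> z = z \<otimes>\<^bsub>G\<^esub> y \<longrightarrow> x \<otimes>\<^bsub>G\<^esub> z = z \<otimes>\<^bsub>G\<^esub> x)"

section \<open>Centralizers, the centre and abelian subgroups of index at most 2\<close>

context group
begin

lemma inv_mult_cancel_left:
  assumes "x \<in> carrier G" "y \<in> carrier G"
  shows "inv x \<otimes> (x \<otimes> y) = y" "x \<otimes> (inv x \<otimes> y) = y"
  using assms by (simp_all flip: m_assoc)

lemma inv_commute:
  assumes "x \<in> carrier G" "y \<in> carrier G" "x \<otimes> y = y \<otimes> x"
  shows "inv x \<otimes> y = y \<otimes> inv x"
  using assms by (metis inv_closed inv_solve_left inv_solve_right m_assoc m_closed)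

lemma mult_commute:
  assumes "x \<in> carrier G" "y \<in> carrier G" "z \<in> carrier G" "x \<otimes> z = z \<otimes> x" "y \<otimes> z = z \<otimes> y"
  shows "(x \<otimes> y) \<otimes> z = z \<otimes> (x \<otimes> y)"
  using assms by (metis m_assoc)

lemma subgroup_centralizer:
  assumes "S \<subseteq> carrier G"
  shows "subgroup (centralizer G S) G"
  using assms inv_commute mult_commute
  by (intro subgroupI) (auto simp: centralizer_def subset_iff intro!: exI[of _ \<one>])

lemma group_center_eq_centralizer: "group_center G = centralizer G (carrier G)"
  by (auto simp: group_center_def centralizer_def)

lemma subgroup_group_center: "subgroup (group_center G) G"
  by (simp add: group_center_eq_centralizer subgroup_centralizer)

lemma group_center_closed: "group_center G \<subseteq> carrier G"
  by (auto simp: group_center_def)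

lemma group_centerD: "z \<in> group_center G \<Longrightarrow> g \<in> carrier G \<Longrightarrow> z \<otimes> g = g \<otimes> z"
  by (simp add: group_center_def)

lemma normal_group_center: "group_center G \<lhd> G"
proof (rule normal_invI[OF subgroup_group_center])
  fix x h assume "x \<in> carrier G" "h \<in> group_center G"
  then show "x \<otimes> h \<otimes> inv x \<in> group_center G"
    by (metis group_centerD group_center_closed inv_solve_right' subsetD m_closed)
qed

text \<open>A double centralizer argument: \<open>generate G S\<close> centralizes \<open>S\<close>,
  hence \<open>S\<close> centralizes \<open>generate G S\<close>, and so does everything that
  \<open>S\<close> generates.\<close>

lemma generate_commute:
  assumes S: "S \<subseteq> carrier G" and comm: "\<And>a b. a \<in> S \<Longrightarrow> b \<in> S \<Longrightarrow> a \<otimes> b = b \<otimes> a"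
    and a: "a \<in> generate G S" and b: "b \<in> generate G S"
  shows "a \<otimes> b = b \<otimes> a"
proof -
  have "generate G S \<subseteq> centralizer G S"
    using S comm by (intro generate_subgroup_incl subgroup_centralizer) (auto simp: centralizer_def)
  then have "S \<subseteq> centralizer G (generate G S)"
    using S by (auto simp: centralizer_def)
  then have "generate G S \<subseteq> centralizer G (generate G S)"
    using S by (intro generate_subgroup_incl subgroup_centralizer generate_incl)
  then show ?thesis
    using a b by (auto simp: centralizer_def)
qed

text \<open>By \<open>index\<close> the complement of \<open>A\<close> lies in a single coset. An
  element of \<open>A\<close> that commutes with one \<open>y\<close> outside \<open>A\<close>
  therefore commutes with \<open>A\<close> and with the whole coset of \<open>y\<close>, so it is
  central. Transitivity follows by a case split on whether the middle element lies in
  \<open>A\<close>.\<close>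

lemma commuting_transitive_if_abelian_index_2:
  assumes A: "subgroup A G" and comm: "\<And>a b. a \<in> A \<Longrightarrow> b \<in> A \<Longrightarrow> a \<otimes> b = b \<otimes> a"
    and index: "\<And>x y. x \<in> carrier G - A \<Longrightarrow> y \<in> carrier G - A \<Longrightarrow> x \<otimes> inv y \<in> A"
  shows "commuting_transitive G"
proof -
  have AG: "a \<in> carrier G" if "a \<in> A" for a
    using A that by (rule subgroup.mem_carrier)
  have decomp: "\<exists>a\<in>A. x = a \<otimes> y" if "x \<in> carrier G - A" "y \<in> carrier G - A" for x y
    using index[OF that] that by (intro bexI[of _ "x \<otimes> inv y"]) (auto simp: m_assoc)
  have central: "a \<in> group_center G"
    if a: "a \<in> A" and y: "y \<in> carrier G - A" and ay: "a \<otimes> y = y \<otimes> a" for a y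
  proof -
    have "g \<otimes> a = a \<otimes> g" if g: "g \<in> carrier G" for g
    proof (cases "g \<in> A")
      case True
      then show ?thesis using a by (rule comm)
    next
      case False
      then obtain c where c: "c \<in> A" "g = c \<otimes> y"
        using decomp[of g y] g y by blast
      have "y \<in> carrier G"
        using y by blast
      then show ?thesis
        unfolding c(2) by (rule mult_commute[OF AG[OF c(1)] _ AG[OF a] comm[OF c(1) a] ay[symmetric]])
    qed
    then show ?thesis
      using AG[OF a] unfolding group_center_def by blast
  qed
  show ?thesis
    unfolding commuting_transitive_def
  proof (intro ballI impI)
    fix x y z
    assume x: "x \<in> carrier G - group_center G" and y: "y \<in> carrier G - group_center G"
      and z: "z \<in> carrier G - group_center G"
      and xy: "x \<otimes> y = y \<otimes> x" and yz: "y \<otimes> z = z \<otimes> y"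
    have yG: "y \<in> carrier G"
      using y by blast
    show "x \<otimes> z = z \<otimes> x"
    proof (cases "y \<in> A")
      case True
      \<comment> \<open>If \<open>x\<close> or \<open>z\<close> were outside \<open>A\<close>, then
        \<open>y\<close>, which lies in \<open>A\<close> and commutes with it, would be
        central.\<close>
      then have "x \<in> A" "z \<in> A"
        using central[of y x] central[of y z] x y z xy yz by auto
      then show ?thesis by (rule comm)
    next
      case False
      \<comment> \<open>A non-central \<open>u\<close> commuting with \<open>y\<close> cannot lie in
        \<open>A\<close>, so it is \<open>a \<otimes> y\<close> with \<open>a\<close> in
        \<open>A\<close>; cancelling \<open>y\<close> shows that \<open>a\<close> commutes with
        \<open>y\<close> and is central.\<close>
      have *: "\<exists>a\<in>group_center G. u = a \<otimes> y"
        if u: "u \<in> carrier G - group_center G" and uy: "u \<otimes> y = y \<otimes> u" for u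
      proof -
        have "u \<notin> A"
          using central[OF _ _ uy] u yG False by blast
        then obtain a where a: "a \<in> A" "u = a \<otimes> y"
          using decomp[of u y] u yG False by blast
        have "a \<otimes> y \<otimes> y = y \<otimes> a \<otimes> y"
          using uy m_assoc[OF yG AG[OF a(1)] yG] unfolding a(2) by simp
        then have "a \<otimes> y = y \<otimes> a"
          using yG AG[OF a(1)] by simp
        then have "a \<in> group_center G"
          using central[OF a(1)] yG False by blast
        with a(2) show ?thesis by blast
      qed
      obtain a where a: "a \<in> group_center G" "x = a \<otimes> y"
        using *[OF x xy] by blast
      have "z \<in> carrier G" "a \<in> carrier G"
        using z a(1) group_center_closed by blast+
      then show ?thesis
        unfolding a(2) by (intro mult_commute yG group_centerD[OF a(1)] yz)
    qed
  qed
qed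

text \<open>The subgroup generated by \<open>s\<close>, \<open>t\<^sup>2\<close> and the centre is abelian, and \<open>t\<close> normalizes it.\<close>

lemma commuting_transitive_if_two_generators:
  assumes s: "s \<in> carrier G" and t: "t \<in> carrier G"
    and gen: "carrier G = generate G ({s, t} \<union> group_center G)"
    and comm: "t \<otimes> t \<otimes> s = s \<otimes> (t \<otimes> t)"
    and conj: "t \<otimes> s \<otimes> inv t \<in> generate G ({s, t \<otimes> t} \<union> group_center G)"
  shows "commuting_transitive G"
proof -
  let ?S = "{s, t \<otimes> t} \<union> group_center G"
  define A where "A = generate G ?S"
  have S: "?S \<subseteq> carrier G"
    using s t group_center_closed by auto
  have A: "subgroup A G"
    unfolding A_def by (rule generate_is_subgroup[OF S])
  interpret A: subgroup A G by (rule A)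
  have SA: "?S \<subseteq> A"
    by (auto simp: A_def intro: generate.incl)
  \<comment> \<open>Puts \<open>inv t\<close> into the coset of \<open>t\<close>, as
    \<open>cover\<close> needs for the inverse of a generator.\<close>
  have inv_t: "inv t = inv (t \<otimes> t) \<otimes> t"
    using t by (simp add: inv_mult_group m_assoc)
  have base: "t \<otimes> h \<otimes> inv t \<in> A" if h: "h \<in> ?S" for h
  proof -
    have "t \<otimes> (t \<otimes> t) \<otimes> inv t = t \<otimes> t"
      using t by (simp add: m_assoc)
    moreover have "t \<otimes> h \<otimes> inv t = h" if "h \<in> group_center G"
      using that t group_centerD group_center_closed by (metis inv_solve_right' m_closed subsetD)
    moreover have "t \<otimes> s \<otimes> inv t \<in> A"
      using conj by (simp add: A_def)
    ultimately show ?thesis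
      using h SA by (elim UnE insertE emptyE) auto
  qed
  \<comment> \<open>Conjugation by \<open>t\<close> is a homomorphism, so the generators treated in
    \<open>base\<close> suffice.\<close>
  have conjA: "t \<otimes> a \<otimes> inv t \<in> A" if "a \<in> A" for a
    using that[unfolded A_def]
  proof (induction rule: generate.induct)
    case one
    then show ?case using t by simp
  next
    case (incl h)
    then show ?case by (rule base)
  next
    case (inv h)
    then have "h \<in> carrier G"
      using S by blast
    then have "t \<otimes> inv h \<otimes> inv t = inv (t \<otimes> h \<otimes> inv t)"
      using t by (simp add: inv_mult_group m_assoc)
    then show ?case
      using base[OF inv] by simp
  next
    case (eng h1 h2)
    have "h1 \<in> carrier G" "h2 \<in> carrier G"
      using eng S generate_in_carrier by blast+
    then have "t \<otimes> (h1 \<otimes> h2) \<otimes> inv t = (t \<otimes> h1 \<otimes> inv t) \<otimes> (t \<otimes> h2 \<otimes> inv t)"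
      using t by (simp add: m_assoc inv_solve_left)
    then show ?case
      using eng.IH by simp
  qed
  \<comment> \<open>The union of \<open>A\<close> and its coset of \<open>t\<close> is closed under
    products, because \<open>t\<close> normalizes \<open>A\<close> and \<open>t \<otimes> t\<close>
    lies in \<open>A\<close>.\<close>
  have cover: "g \<in> A \<or> (\<exists>a\<in>A. g = a \<otimes> t)" if "g \<in> generate G ({s, t} \<union> group_center G)" for g
    using that
  proof (induction rule: generate.induct)
    case one
    then show ?case by simp
  next
    case (incl h)
    then show ?case using SA t by (auto intro!: bexI[of _ \<one>])
  next
    case (inv h)
    show ?case
    proof (cases "h = t")
      case True
      have "inv (t \<otimes> t) \<in> A"
        using SA by (intro A.m_inv_closed) blast
      then show ?thesis
        unfolding True using inv_t by blast
    next
      case False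
      then have "h \<in> A"
        using inv SA by blast
      then show ?thesis by simp
    qed
  next
    case (eng g h)
    have 1: "t \<otimes> b = (t \<otimes> b \<otimes> inv t) \<otimes> t" if "b \<in> A" for b
      using that t by (simp add: m_assoc)
    have tt: "t \<otimes> t \<in> A"
      using SA by simp
    consider "g \<in> A" "h \<in> A" | b where "g \<in> A" "b \<in> A" "h = b \<otimes> t"
      | a where "a \<in> A" "g = a \<otimes> t" "h \<in> A"
      | a b where "a \<in> A" "g = a \<otimes> t" "b \<in> A" "h = b \<otimes> t"
      using eng by blast
    then show ?case
    proof cases
      case (2 b)
      then have "g \<otimes> h = (g \<otimes> b) \<otimes> t" using t by (simp add: m_assoc)
      with 2 show ?thesis by blast
    next
      case (3 a)
      then have "g \<otimes> h = (a \<otimes> (t \<otimes> h \<otimes> inv t)) \<otimes> t" using t by (simp add: m_assoc)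
      moreover have "a \<otimes> (t \<otimes> h \<otimes> inv t) \<in> A"
        using 3 conjA by auto
      ultimately show ?thesis by blast
    next
      case (4 a b)
      \<comment> \<open>Two elements of the coset multiply into \<open>A\<close>: a factor
        \<open>inv t \<otimes> t\<close> is inserted after \<open>t \<otimes> b\<close>.\<close>
      have "g \<otimes> h = a \<otimes> (t \<otimes> b) \<otimes> t" using 4 t by (simp add: m_assoc)
      also have "\<dots> = a \<otimes> (t \<otimes> b \<otimes> inv t) \<otimes> (t \<otimes> t)"
        using 4 t by (subst 1) (simp_all add: m_assoc inv_mult_cancel_left)
      finally have "g \<otimes> h \<in> A" using 4 conjA tt by auto
      then show ?thesis by blast
    qed simp
  qed
  show ?thesis
  proof (rule commuting_transitive_if_abelian_index_2[OF A])
    \<comment> \<open>Apart from central elements only \<open>s\<close> and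
      \<open>t \<otimes> t\<close> have to commute, and this is \<open>comm\<close>.\<close>
    have "a \<otimes> b = b \<otimes> a" if ab: "a \<in> ?S" "b \<in> ?S" for a b
    proof -
      consider "a \<in> group_center G" | "b \<in> group_center G" | "a \<in> {s, t \<otimes> t}" "b \<in> {s, t \<otimes> t}"
        using ab by blast
      then show ?thesis
        using ab S group_centerD[of a b] group_centerD[of b a] comm by cases auto
    qed
    then show "a \<otimes> b = b \<otimes> a" if "a \<in> A" "b \<in> A" for a b
      using that generate_commute[OF S] unfolding A_def by blast
  next
    fix x y assume x: "x \<in> carrier G - A" and y: "y \<in> carrier G - A"
    obtain a where a: "a \<in> A" "x = a \<otimes> t"
      using cover[of x] x unfolding gen[symmetric] by auto
    obtain b where b: "b \<in> A" "y = b \<otimes> t"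
      using cover[of y] y unfolding gen[symmetric] by auto
    note ab = a b
    then have "x \<otimes> inv y = a \<otimes> inv b"
      using t by (simp add: inv_mult_group m_assoc inv_mult_cancel_left)
    then show "x \<otimes> inv y \<in> A"
      using ab by simp
  qed
qed

text \<open>Conjugating by \<open>t\<close> twice sends \<open>s\<close> to
  \<open>z \<otimes> inv (z \<otimes> inv s) = s\<close>, so \<open>t \<otimes> t\<close> commutes
  with \<open>s\<close>. The conjugate \<open>z \<otimes> inv s\<close> lies in the subgroup
  generated by \<open>s\<close>, \<open>t \<otimes> t\<close> and the centre.\<close>

lemma commuting_transitive_if_inverted:
  assumes s: "s \<in> carrier G" and t: "t \<in> carrier G"
    and gen: "carrier G = generate G ({s, t} \<union> group_center G)"
    and z: "z \<in> group_center G" and conj: "t \<otimes> s \<otimes> inv t = z \<otimes> inv s"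
  shows "commuting_transitive G"
proof (rule commuting_transitive_if_two_generators[OF s t gen])
  have zG: "z \<in> carrier G" using z group_center_closed by blast
  have ts: "t \<otimes> s = z \<otimes> inv s \<otimes> t"
    using conj s t zG by (metis inv_closed inv_solve_right' m_closed)
  \<comment> \<open>The conjugation hypothesis rewritten without inverses.\<close>
  have st: "s \<otimes> t \<otimes> s = z \<otimes> t"
  proof -
    have "s \<otimes> t \<otimes> s = s \<otimes> (t \<otimes> s)"
      using s t by (rule m_assoc[OF _ _ s])
    also have "\<dots> = (s \<otimes> z) \<otimes> (inv s \<otimes> t)"
      using s t zG by (simp only: ts) (simp add: m_assoc)
    also have "\<dots> = z \<otimes> t"
      using s t zG by (simp add: m_assoc inv_mult_cancel_left flip: group_centerD[OF z s])
    finally show ?thesis .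
  qed
  \<comment> \<open>The product \<open>s t s t s\<close> is evaluated in two ways, replacing the
    first or the last \<open>s t s\<close> by \<open>z t\<close>.\<close>
  have "z \<otimes> (t \<otimes> (t \<otimes> s)) = z \<otimes> (s \<otimes> (t \<otimes> t))"
  proof -
    have "z \<otimes> (t \<otimes> (t \<otimes> s)) = (s \<otimes> t \<otimes> s) \<otimes> (t \<otimes> s)"
      using s t zG st by (simp add: m_assoc)
    also have "\<dots> = s \<otimes> t \<otimes> (s \<otimes> t \<otimes> s)"
      using s t by (simp add: m_assoc)
    also have "\<dots> = s \<otimes> t \<otimes> (z \<otimes> t)"
      using st by simp
    also have "\<dots> = z \<otimes> (s \<otimes> t) \<otimes> t"
      using s t zG group_centerD[OF z, of "s \<otimes> t"] by (simp add: m_assoc)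
    finally show ?thesis using s t zG by (simp add: m_assoc)
  qed
  then show "t \<otimes> t \<otimes> s = s \<otimes> (t \<otimes> t)"
    using s t zG by (simp add: m_assoc)
  show "t \<otimes> s \<otimes> inv t \<in> generate G ({s, t \<otimes> t} \<union> group_center G)"
    unfolding conj using z by (intro generate.eng generate.inv generate.incl) auto
qed

section \<open>Central quotients of order \<open>p * p\<close>\<close>

lemma card_subgroup_dvd:
  assumes "subgroup H G" "subgroup K G" "H \<subseteq> K"
  shows "card H dvd card K"
proof -
  interpret K: group "G\<lparr>carrier := K\<rparr>"
    by (rule subgroup_imp_group[OF assms(2)])
  have "subgroup H (G\<lparr>carrier := K\<rparr>)"
    by (rule subgroup_incl[OF assms])
  from K.lagrange[OF this] show ?thesis
    using dvd_triv_right[of "card H" "card (rcosets\<^bsub>G\<lparr>carrier := K\<rparr>\<^esub> H)"]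
    by (simp add: Coset.order_def)
qed

text \<open>The centre, \<open>centralizer G {x, y}\<close>, \<open>centralizer G {y}\<close> and
  \<open>G\<close> form a chain with successive indices \<open>a\<close>, \<open>b\<close>,
  \<open>c\<close> whose product is \<open>p * p\<close>. The outer two inclusions are proper and
  use up both factors \<open>p\<close>, so the two centralizers coincide. The second contains
  \<open>z\<close>, hence \<open>z\<close> commutes with \<open>x\<close>.\<close>

lemma commuting_transitive_if_center_index_prime_square:
  assumes fin: "finite (carrier G)" and p: "Factorial_Ring.prime (p::nat)"
    and ord: "card (carrier (G Mod group_center G)) = p * p"
  shows "commuting_transitive G"
  unfolding commuting_transitive_def
proof (intro ballI impI)
  fix x y z
  assume x: "x \<in> carrier G - group_center G" and y: "y \<in> carrier G - group_center G"
    and z: "z \<in> carrier G - group_center G"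
    and xy: "x \<otimes> y = y \<otimes> x" and yz: "y \<otimes> z = z \<otimes> y"
  let ?Z = "group_center G" and ?C = "centralizer G {y}" and ?D = "centralizer G {x, y}"
  have C: "subgroup ?C G" and D: "subgroup ?D G"
    using x y by (auto intro: subgroup_centralizer)
  \<comment> \<open>The non-central \<open>x\<close> lies in \<open>?D\<close>, so the first
    inclusion is proper; as \<open>y\<close> is non-central, \<open>?C\<close> is not all of
    \<open>G\<close>.\<close>
  have ZD: "?Z \<subset> ?D" and DC: "?D \<subseteq> ?C" and CG: "?C \<subset> carrier G"
    using x y xy by (auto simp: group_center_def centralizer_def)
  have "0 < card ?Z"
    using fin subgroup_group_center finite_subset[OF group_center_closed]
    by (metis card_gt_0_iff empty_iff subgroup.one_closed)
  obtain a where a: "card ?D = card ?Z * a"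
    using card_subgroup_dvd[OF subgroup_group_center D] ZD by auto
  obtain b where b: "card ?C = card ?D * b"
    using card_subgroup_dvd[OF D C DC] by auto
  obtain c where c: "card (carrier G) = card ?C * c"
    using card_subgroup_dvd[OF C subgroup_self] CG by auto
  have "card (carrier G) = p * p * card ?Z"
    using lagrange[OF subgroup_group_center] ord by (simp add: FactGroup_def Coset.order_def)
  then have abc: "a * b * c = p * p"
    using a b c \<open>0 < card ?Z\<close> by simp
  have "card ?Z < card ?D" "card ?C < card (carrier G)"
    using ZD CG fin DC by (auto intro!: psubset_card_mono finite_subset[of ?D "carrier G"])
  then have "a \<noteq> 1" "c \<noteq> 1"
    using a c by auto
  moreover have "a dvd p\<^sup>2" "c dvd p\<^sup>2"
    by (simp_all add: power2_eq_square flip: abc)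
  \<comment> \<open>A divisor of \<open>p * p\<close> other than 1 is a multiple of
    \<open>p\<close>; then \<open>p * b * p\<close> divides \<open>p * p\<close>, which forces
    \<open>b = 1\<close>.\<close>
  ultimately have "p dvd a" "p dvd c"
    using p by (auto simp: divides_primepow_nat)
  then have "p * b * p dvd p * p"
    unfolding abc[symmetric] by (intro mult_dvd_mono dvd_refl)
  then have "b = 1"
    using p by (simp add: prime_gt_0_nat)
  then have "?D = ?C"
    using b DC fin C by (intro card_subset_eq) (auto intro: finite_subset dest: subgroup.subset)
  moreover have "z \<in> ?C"
    using z yz by (simp add: centralizer_def)
  ultimately have "z \<in> ?D"
    by simp
  then show "x \<otimes> z = z \<otimes> x"
    by (simp add: centralizer_def)
qed

end

subsection \<open>Commuting conjugacy classes\<close>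

lemma (in group) conj_mult:
  assumes "h \<in> carrier G" "x \<in> carrier G" "y \<in> carrier G"
  shows "(h \<otimes> x \<otimes> inv h) \<otimes> (h \<otimes> y \<otimes> inv h) = h \<otimes> (x \<otimes> y) \<otimes> inv h"
  using assms by (simp add: m_assoc inv_mult_cancel_left)

lemma (in group) conj_conj:
  assumes "g \<in> carrier G" "h \<in> carrier G" "x \<in> carrier G"
  shows "h \<otimes> (g \<otimes> x \<otimes> inv g) \<otimes> inv h = (h \<otimes> g) \<otimes> x \<otimes> inv (h \<otimes> g)"
  using assms by (simp add: m_assoc inv_mult_group)

lemma (in group) conj_class_conj:
  assumes "x \<in> carrier G" "x' \<in> conj_class G x" "h \<in> carrier G"
  shows "h \<otimes> x' \<otimes> inv h \<in> conj_class G x"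
proof -
  obtain g where g: "g \<in> carrier G" "x' = g \<otimes> x \<otimes> inv g"
    using assms(2) by (auto simp: conj_class_def)
  then have "h \<otimes> x' \<otimes> inv h = (h \<otimes> g) \<otimes> x \<otimes> inv (h \<otimes> g)"
    using assms by (simp only: conj_conj)
  moreover have "h \<otimes> g \<in> carrier G"
    using g assms by simp
  ultimately show ?thesis
    unfolding conj_class_def by blast
qed

lemma (in group) conj_class_conjugate:
  assumes y: "y \<in> carrier G" and "y' \<in> conj_class G y" "y'' \<in> conj_class G y"
  obtains h where "h \<in> carrier G" "y'' = h \<otimes> y' \<otimes> inv h"
proof -
  obtain g k where g: "g \<in> carrier G" "y' = g \<otimes> y \<otimes> inv g"
    and k: "k \<in> carrier G" "y'' = k \<otimes> y \<otimes> inv k"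
    using assms by (auto simp: conj_class_def)
  have "y'' = (k \<otimes> inv g) \<otimes> y' \<otimes> inv (k \<otimes> inv g)"
    using y g k by (simp add: m_assoc inv_mult_group inv_mult_cancel_left)
  with g k show ?thesis
    using that[of "k \<otimes> inv g"] by simp
qed

text \<open>The centre is normal, so if \<open>x'\<close> were central, conjugating it back would
  make \<open>x\<close> central.\<close>

lemma (in group) conj_class_noncentral:
  assumes x: "x \<in> carrier G - group_center G" and x': "x' \<in> conj_class G x"
  shows "x' \<in> carrier G - group_center G"
proof -
  obtain g where g: "g \<in> carrier G" "x' = g \<otimes> x \<otimes> inv g"
    using x' by (auto simp: conj_class_def)
  have "inv g \<otimes> x' \<otimes> g = x"
    using g x conj_conj[of g "inv g" x] by simp
  then have "x' \<notin> group_center G"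
    using normal.inv_op_closed1[OF normal_group_center g(1), of x'] x by auto
  then show ?thesis
    using g x by simp
qed

lemma ccc_graph_arc_iff:
  "(A, B) \<in> parcs (ccc_graph G) \<longleftrightarrow>
     A \<in> conj_class G ` (carrier G - group_center G) \<and> B \<in> conj_class G ` (carrier G - group_center G) \<and>
     A \<noteq> B \<and> (\<exists>x\<in>A. \<exists>y\<in>B. x \<otimes>\<^bsub>G\<^esub> y = y \<otimes>\<^bsub>G\<^esub> x)"
  by (simp add: ccc_graph_def Let_def)

text \<open>The two arcs may use different representatives \<open>y'\<close> and \<open>y''\<close>
  of \<open>B\<close>. Some \<open>h\<close> conjugates the first to the second; it carries
  \<open>x'\<close> to an element \<open>x''\<close> of \<open>A\<close> that commutes with
  \<open>y''\<close>. Transitivity then applies to the non-central elements \<open>x''\<close>,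
  \<open>y''\<close>, \<open>z'\<close>.\<close>

lemma (in group) ccc_graph_arcs_trans:
  assumes comm_trans: "commuting_transitive G"
    and AB: "(A, B) \<in> parcs (ccc_graph G)" and BC: "(B, C) \<in> parcs (ccc_graph G)" and "A \<noteq> C"
  shows "(A, C) \<in> parcs (ccc_graph G)"
proof -
  obtain x y z where x: "x \<in> carrier G - group_center G" "A = conj_class G x"
    and y: "y \<in> carrier G - group_center G" "B = conj_class G y"
    and z: "z \<in> carrier G - group_center G" "C = conj_class G z"
    using AB BC unfolding ccc_graph_arc_iff by blast
  obtain x' y' where 1: "x' \<in> A" "y' \<in> B" "x' \<otimes> y' = y' \<otimes> x'"
    using AB unfolding ccc_graph_arc_iff by blast
  obtain y'' z' where 2: "y'' \<in> B" "z' \<in> C" "y'' \<otimes> z' = z' \<otimes> y''"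
    using BC unfolding ccc_graph_arc_iff by blast
  obtain h where h: "h \<in> carrier G" "y'' = h \<otimes> y' \<otimes> inv h"
    using conj_class_conjugate y 1(2) 2(1) by (metis DiffD1)
  define x'' where "x'' = h \<otimes> x' \<otimes> inv h"
  have x'': "x'' \<in> A"
    using conj_class_conj x 1(1) h(1) by (simp add: x''_def)
  have noncentral: "x'' \<in> carrier G - group_center G" "y'' \<in> carrier G - group_center G"
    "z' \<in> carrier G - group_center G"
    using conj_class_noncentral x y z x'' 2 by blast+
  have "x' \<in> carrier G" "y' \<in> carrier G"
    using conj_class_noncentral x y 1 by blast+
  then have "x'' \<otimes> y'' = y'' \<otimes> x''"
    using 1(3) by (simp add: x''_def h conj_mult)
  then have "x'' \<otimes> z' = z' \<otimes> x''"
    using comm_trans noncentral 2(3) unfolding commuting_transitive_def by blast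
  then have "\<exists>x\<in>A. \<exists>z\<in>C. x \<otimes> z = z \<otimes> x"
    using x'' 2(2) by blast
  then show ?thesis
    using AB BC \<open>A \<noteq> C\<close> unfolding ccc_graph_arc_iff by blast
qed

subsection \<open>Groups whose central quotient is presented\<close>

text \<open>Evaluation acts on words and not on their classes, since the elements chosen by
  \<open>f\<close> need not satisfy the relations.\<close>

primrec word_value :: "('a, 'b) monoid_scheme \<Rightarrow> ('g \<Rightarrow> 'a) \<Rightarrow> 'g letter list \<Rightarrow> 'a" where
  "word_value G f [] = \<one>\<^bsub>G\<^esub>"
| "word_value G f (l # w) = (case l of Gen g \<Rightarrow> f g | Inv g \<Rightarrow> inv\<^bsub>G\<^esub> (f g)) \<otimes>\<^bsub>G\<^esub> word_value G f w"

text \<open>A common setting for both kinds of hypothesis: an isomorphism from \<open>G\<close> has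
  trivial kernel, and an isomorphism from the central quotient, composed with the projection, has
  the centre as kernel. The map \<open>f\<close> chooses preimages of the generators.\<close>

locale central_presentation = group_hom G "presented_group R" h
  for G :: "('a, 'b) monoid_scheme" (structure) and R :: "('g letter list \<times> 'g letter list) set"
    and h :: "'a \<Rightarrow> 'g letter list set" +
  fixes f :: "'g \<Rightarrow> 'a"
  assumes kernel_central: "kernel G (presented_group R) h \<subseteq> group_center G"
    and lift_closed: "f g \<in> carrier G"
    and hom_lift: "h (f g) = word_class R [Gen g]"
begin

lemma word_value_closed: "word_value G f w \<in> carrier G"
  by (induction w) (auto simp: lift_closed split: letter.split)

lemma inv_word_class_Gen:
  "inv\<^bsub>presented_group R\<^esub> (word_class R [Gen g]) = word_class R [Inv g]"
proof (rule H.inv_equality)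
  have "word_class R [Inv g] \<otimes>\<^bsub>presented_group R\<^esub> word_class R [Gen g] = word_class R []"
    unfolding presented_group_mult word_class_eq_iff by (simp add: word_eq.inv_gen)
  then show "word_class R [Inv g] \<otimes>\<^bsub>presented_group R\<^esub> word_class R [Gen g] = \<one>\<^bsub>presented_group R\<^esub>"
    by (simp add: presented_group_def)
qed (simp_all add: presented_group_def)

lemma hom_word_value: "h (word_value G f w) = word_class R w"
proof (induction w)
  case Nil
  then show ?case by (simp add: presented_group_def)
next
  case (Cons l w)
  then show ?case
    by (cases l)
      (simp_all add: word_value_closed lift_closed hom_lift inv_word_class_Gen presented_group_mult)
qed

text \<open>Both sides have the same image under \<open>h\<close>, so they differ by an element of
  the kernel: relations lift to \<open>G\<close> up to a central factor.\<close>

lemma word_value_cong: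
  assumes "(u, v) \<in> R"
  obtains z where "z \<in> group_center G" "word_value G f u = z \<otimes> word_value G f v"
proof
  let ?z = "word_value G f u \<otimes> inv (word_value G f v)"
  have "h (word_value G f u) = h (word_value G f v)"
    using assms by (simp add: hom_word_value word_class_eq_iff word_eq.rel)
  then have "?z \<in> kernel G (presented_group R) h"
    by (simp add: kernel_def word_value_closed)
  then show "?z \<in> group_center G"
    using kernel_central by blast
  show "word_value G f u = ?z \<otimes> word_value G f v"
    by (simp add: G.m_assoc word_value_closed)
qed

text \<open>For injective \<open>h\<close> the central factor disappears; the cases
  \<open>SD8n\<close> and \<open>V8n\<close> rely on this.\<close>

lemma word_value_cong_inj:
  assumes "inj_on h (carrier G)" "(u, v) \<in> R"
  shows "word_value G f u = word_value G f v"
proof (rule inj_onD[OF assms(1)])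
  show "h (word_value G f u) = h (word_value G f v)"
    using assms(2) by (simp add: hom_word_value word_class_eq_iff word_eq.rel)
qed (rule word_value_closed)+

lemma word_value_in_generate: "word_value G f w \<in> generate G (range f)"
  by (induction w) (auto split: letter.split intro!: generate.one generate.eng intro: generate.incl generate.inv)

text \<open>If the word \<open>w\<close> represents \<open>h g\<close>, then \<open>g\<close> and
  the value of \<open>w\<close> differ by an element of the kernel, which is central.\<close>

lemma carrier_eq_generate: "carrier G = generate G (range f \<union> group_center G)"
proof
  have "range f \<subseteq> carrier G"
    by (auto simp: lift_closed)
  then show "generate G (range f \<union> group_center G) \<subseteq> carrier G"
    by (intro G.generate_incl) (simp add: G.group_center_closed)
  show "carrier G \<subseteq> generate G (range f \<union> group_center G)"
  proof
    fix g assume g: "g \<in> carrier G"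
    then have "h g \<in> carrier (presented_group R)"
      by simp
    then obtain w where w: "h g = word_class R w"
      by (auto simp: presented_group_def)
    let ?v = "word_value G f w"
    have "g \<otimes> inv ?v \<in> kernel G (presented_group R) h"
      using g word_value_closed by (simp add: kernel_def hom_word_value w)
        (simp flip: hom_word_value[of w] add: word_value_closed)
    then have "g \<otimes> inv ?v \<in> group_center G"
      using kernel_central by blast
    moreover have "?v \<in> generate G (range f \<union> group_center G)"
      using word_value_in_generate G.mono_generate[of "range f" "range f \<union> group_center G"] by blast
    ultimately have "(g \<otimes> inv ?v) \<otimes> ?v \<in> generate G (range f \<union> group_center G)"
      by (intro generate.eng[OF generate.incl]) auto
    then show "g \<in> generate G (range f \<union> group_center G)"
      using g word_value_closed by (simp add: G.m_assoc)
  qed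
qed

lemma carrier_eq_generate_two:
  assumes "UNIV = {s, t}"
  shows "carrier G = generate G ({f s, f t} \<union> group_center G)"
  using carrier_eq_generate by (simp add: assms)

lemma commuting_transitive_if_rel_inverted:
  assumes st: "UNIV = {s, t}" and R: "([Gen t, Gen s, Inv t], [Inv s]) \<in> R"
  shows "commuting_transitive G"
proof -
  obtain z where z: "z \<in> group_center G" "f t \<otimes> (f s \<otimes> inv (f t)) = z \<otimes> inv (f s)"
    using word_value_cong[OF R] by (auto simp: lift_closed)
  show ?thesis
    by (rule G.commuting_transitive_if_inverted[OF _ _ carrier_eq_generate_two[OF st] z(1)])
      (use z(2) in \<open>simp_all add: lift_closed G.m_assoc\<close>)
qed

text \<open>Conjugation in either direction amounts to the same equation
  \<open>?s \<otimes> ?t \<otimes> ?s = z \<otimes> ?t\<close>, so the mirrored relation can be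
  turned around with the same \<open>z\<close>.\<close>

lemma commuting_transitive_if_rel_inverted':
  assumes st: "UNIV = {s, t}" and R: "([Inv t, Gen s, Gen t], [Inv s]) \<in> R"
  shows "commuting_transitive G"
proof -
  let ?s = "f s" and ?t = "f t"
  have c: "?s \<in> carrier G" "?t \<in> carrier G"
    by (simp_all add: lift_closed)
  obtain z where z: "z \<in> group_center G" "inv ?t \<otimes> (?s \<otimes> ?t) = z \<otimes> inv ?s"
    using word_value_cong[OF R] by (auto simp: lift_closed)
  have zG: "z \<in> carrier G"
    using z(1) G.group_center_closed by blast
  have "?s \<otimes> ?t = ?t \<otimes> (z \<otimes> inv ?s)"
    using z(2) c zG by (metis G.inv_closed G.inv_solve_left G.m_closed)
  then have "?s \<otimes> ?t = z \<otimes> (?t \<otimes> inv ?s)"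
    using c zG G.group_centerD[OF z(1) c(2)] by (metis G.inv_closed G.m_assoc)
  then have "?s \<otimes> ?t \<otimes> ?s = z \<otimes> ?t"
    using c zG by (simp add: G.m_assoc)
  then have "?t \<otimes> ?s = inv ?s \<otimes> (z \<otimes> ?t)"
    using c zG by (metis G.inv_solve_left G.m_assoc G.m_closed)
  then have "?t \<otimes> ?s = z \<otimes> inv ?s \<otimes> ?t"
    using c zG G.group_centerD[OF z(1), of "inv ?s"] by (metis G.inv_closed G.m_assoc)
  then have "?t \<otimes> ?s \<otimes> inv ?t = z \<otimes> inv ?s"
    using c zG by (simp add: G.m_assoc)
  with c z(1) show ?thesis
    by (intro G.commuting_transitive_if_inverted[OF _ _ carrier_eq_generate_two[OF st]])
qed

end

section \<open>Central presentations obtained from isomorphisms\<close>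

lemma UNIV_xy: "UNIV = {X, Y}" "UNIV = {Y, X}"
  using xy.nchotomy by blast+

lemma central_presentation_exists:
  fixes G :: "('a, 'b) monoid_scheme"
  assumes "group G" and h: "h \<in> hom G (presented_group R)"
    and surj: "h ` carrier G = carrier (presented_group R)"
    and kernel: "kernel G (presented_group R) h \<subseteq> group_center G"
  obtains f where "central_presentation G R h f"
proof -
  have "\<exists>x. x \<in> carrier G \<and> h x = word_class R [Gen g]" for g
  proof -
    have "word_class R [Gen g] \<in> h ` carrier G"
      unfolding surj by (simp add: presented_group_def)
    then show ?thesis by auto
  qed
  then have "\<exists>f. \<forall>g. f g \<in> carrier G \<and> h (f g) = word_class R [Gen g]"
    by (intro choice) blast
  then obtain f where "f g \<in> carrier G" "h (f g) = word_class R [Gen g]" for g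
    by blast
  moreover have "group_hom G (presented_group R) h"
    using assms by (simp add: group_hom_def group_hom_axioms_def group_presented_group)
  ultimately show ?thesis
    using kernel by (intro that[of f]) (simp add: central_presentation_def central_presentation_axioms_def)
qed

text \<open>Injectivity is passed on so that relations can be lifted exactly.\<close>

lemma iso_central_presentation:
  fixes G :: "('a, 'b) monoid_scheme"
  assumes G: "group G" and "G \<cong> presented_group R"
  obtains h f where "central_presentation G R h f" "inj_on h (carrier G)"
proof -
  interpret group G by (rule G)
  obtain h where h: "h \<in> iso G (presented_group R)"
    using assms(2) by (auto simp: is_iso_def)
  then have inj: "inj_on h (carrier G)" and surj: "h ` carrier G = carrier (presented_group R)"
    and hom: "h \<in> hom G (presented_group R)"
    by (auto simp: iso_def bij_betw_def)
  have "h \<one>\<^bsub>G\<^esub> = \<one>\<^bsub>presented_group R\<^esub>"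
    using hom_one[OF hom G group_presented_group] .
  then have "x = \<one>\<^bsub>G\<^esub>" if "x \<in> kernel G (presented_group R) h" for x
    using inj_onD[OF inj, of x "\<one>\<^bsub>G\<^esub>"] that by (simp add: kernel_def)
  then have "kernel G (presented_group R) h \<subseteq> group_center G"
    using subgroup.one_closed[OF subgroup_group_center] by blast
  from central_presentation_exists[OF G hom surj this] inj show ?thesis
    using that by blast
qed

lemma central_quotient_central_presentation:
  fixes G :: "('a, 'b) monoid_scheme"
  assumes G: "group G" and "G Mod group_center G \<cong> presented_group R"
  obtains h f where "central_presentation G R h f"
proof -
  interpret group G by (rule G)
  interpret Z: normal "group_center G" G by (rule normal_group_center)
  let ?Q = "G Mod group_center G"
  obtain i where i: "i \<in> iso ?Q (presented_group R)"
    using assms(2) by (auto simp: is_iso_def)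
  then have inj: "inj_on i (carrier ?Q)" and surj: "i ` carrier ?Q = carrier (presented_group R)"
    and hom: "i \<in> hom ?Q (presented_group R)"
    by (auto simp: iso_def bij_betw_def)
  define h where "h = i \<circ> (\<lambda>g. group_center G #>\<^bsub>G\<^esub> g)"
  have hom_h: "h \<in> hom G (presented_group R)"
    unfolding h_def by (rule Group.hom_compose[OF Z.r_coset_hom_Mod hom])
  have "(\<lambda>g. group_center G #>\<^bsub>G\<^esub> g) ` carrier G = carrier ?Q"
    by (auto simp: FactGroup_def RCOSETS_def)
  then have surj_h: "h ` carrier G = carrier (presented_group R)"
    unfolding h_def image_comp[symmetric] using surj by simp
  have "kernel G (presented_group R) h \<subseteq> group_center G"
  proof
    fix g assume "g \<in> kernel G (presented_group R) h"
    then have g: "g \<in> carrier G" "i (group_center G #>\<^bsub>G\<^esub> g) = \<one>\<^bsub>presented_group R\<^esub>"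
      by (simp_all add: kernel_def h_def)
    have "i \<one>\<^bsub>?Q\<^esub> = \<one>\<^bsub>presented_group R\<^esub>"
      using hom_one[OF hom Z.factorgroup_is_group group_presented_group] .
    moreover have "group_center G #>\<^bsub>G\<^esub> g \<in> carrier ?Q"
      using g by (auto simp: FactGroup_def RCOSETS_def)
    moreover have "\<one>\<^bsub>?Q\<^esub> \<in> carrier ?Q"
      by (rule monoid.one_closed[OF group.is_monoid[OF Z.factorgroup_is_group]])
    ultimately have "group_center G #>\<^bsub>G\<^esub> g = group_center G"
      using inj_onD[OF inj, of "group_center G #>\<^bsub>G\<^esub> g" "\<one>\<^bsub>?Q\<^esub>"] g by (simp add: FactGroup_def)
    then show "g \<in> group_center G"
      using rcos_self[OF g(1) subgroup_group_center] by simp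
  qed
  from central_presentation_exists[OF G hom_h surj_h this] show ?thesis
    using that by blast
qed

text \<open>Serves the dihedral central quotient and the families \<open>D2n\<close>,
  \<open>T4n\<close>, \<open>U6n\<close> and \<open>Unm\<close>, in each of which conjugation by one
  generator inverts the other.\<close>

lemma commuting_transitive_if_generator_inverted:
  fixes G :: "('a, 'b) monoid_scheme"
  assumes G: "group G"
    and presentation: "G \<cong> presented_group R \<or> G Mod group_center G \<cong> presented_group R"
    and st: "UNIV = {s, t}"
    and rel: "([Gen t, Gen s, Inv t], [Inv s]) \<in> R \<or> ([Inv t, Gen s, Gen t], [Inv s]) \<in> R"
  shows "commuting_transitive G"
proof -
  obtain h f where "central_presentation G R h f"
    using presentation
  proof
    assume "G \<cong> presented_group R"
    then show ?thesis by (rule iso_central_presentation[OF G]) (rule that)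
  next
    assume "G Mod group_center G \<cong> presented_group R"
    then show ?thesis by (rule central_quotient_central_presentation[OF G]) (rule that)
  qed
  then interpret central_presentation G R h f .
  show ?thesis
    using rel
    by (elim disjE) (rule commuting_transitive_if_rel_inverted[OF st]
        commuting_transitive_if_rel_inverted'[OF st], assumption)+
qed

text \<open>The semidihedral case. The square of \<open>?y\<close> is trivial, so it commutes with
  \<open>?x\<close>, and conjugation by \<open>?y\<close> sends \<open>?x\<close> to one of its
  powers.\<close>

lemma commuting_transitive_if_involution_conjugates_to_power:
  assumes G: "group G" and iso: "G \<cong> presented_group R"
    and R: "(replicate 2 (Gen Y), []) \<in> R"
      "([Gen Y, Gen X, Gen Y], replicate m (Gen X)) \<in> R"
  shows "commuting_transitive G"
proof -
  obtain h f where cp: "central_presentation G R h f" and inj: "inj_on h (carrier G)"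
    by (rule iso_central_presentation[OF G iso]) (rule that)
  interpret central_presentation G R h f by (rule cp)
  let ?x = "f X" and ?y = "f Y"
  have c: "?x \<in> carrier G" "?y \<in> carrier G"
    by (simp_all add: lift_closed)
  have yy: "?y \<otimes>\<^bsub>G\<^esub> ?y = \<one>\<^bsub>G\<^esub>"
    using word_value_cong_inj[OF inj R(1)] c by (simp add: numeral_2_eq_2)
  have yxy: "?y \<otimes>\<^bsub>G\<^esub> (?x \<otimes>\<^bsub>G\<^esub> ?y) = word_value G f (replicate (m) (Gen X))"
    using word_value_cong_inj[OF inj R(2)] c by simp
  have gen: "word_value G f (replicate k (Gen X)) \<in> generate G ({?x, ?y \<otimes>\<^bsub>G\<^esub> ?y} \<union> group_center G)" for k
    by (induction k) (auto intro: generate.one generate.eng generate.incl)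
  have "inv\<^bsub>G\<^esub> ?y = ?y"
    using yy c by (simp add: G.inv_equality)
  then have "?y \<otimes>\<^bsub>G\<^esub> ?x \<otimes>\<^bsub>G\<^esub> inv\<^bsub>G\<^esub> ?y = word_value G f (replicate (m) (Gen X))"
    using c by (simp add: G.m_assoc yxy)
  then have conj: "?y \<otimes>\<^bsub>G\<^esub> ?x \<otimes>\<^bsub>G\<^esub> inv\<^bsub>G\<^esub> ?y \<in> generate G ({?x, ?y \<otimes>\<^bsub>G\<^esub> ?y} \<union> group_center G)"
    using gen by metis
  have comm: "?y \<otimes>\<^bsub>G\<^esub> ?y \<otimes>\<^bsub>G\<^esub> ?x = ?x \<otimes>\<^bsub>G\<^esub> (?y \<otimes>\<^bsub>G\<^esub> ?y)"
    using yy c by simp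
  show ?thesis
    by (rule G.commuting_transitive_if_two_generators[OF c carrier_eq_generate_two[OF UNIV_xy(1)] comm conj])
qed

text \<open>The two mixed relations move \<open>?y\<close> past \<open>?x\<close> twice, each time
  inverting both letters involved, so \<open>?y \<otimes> ?y\<close> passes \<open>?x\<close> up to
  the equality of \<open>?y \<otimes> ?y\<close> with its inverse, which comes from the fourth
  power. The same equality turns the conjugate of \<open>?x\<close> into the inverse of
  \<open>?x\<close> times \<open>?y \<otimes> ?y\<close>.\<close>

lemma commuting_transitive_V8n:
  assumes G: "group G" and iso: "G \<cong> presented_group R"
    and R: "(replicate 4 (Gen Y), []) \<in> R"
      "([Gen Y, Gen X], [Inv X, Inv Y]) \<in> R" "([Inv Y, Gen X], [Inv X, Gen Y]) \<in> R"
  shows "commuting_transitive G"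
proof -
  obtain h f where cp: "central_presentation G R h f" and inj: "inj_on h (carrier G)"
    by (rule iso_central_presentation[OF G iso]) (rule that)
  interpret central_presentation G R h f by (rule cp)
  let ?x = "f X" and ?y = "f Y"
  have c: "?x \<in> carrier G" "?y \<in> carrier G"
    by (simp_all add: lift_closed)
  have yyyy: "?y \<otimes>\<^bsub>G\<^esub> (?y \<otimes>\<^bsub>G\<^esub> (?y \<otimes>\<^bsub>G\<^esub> ?y)) = \<one>\<^bsub>G\<^esub>"
    using word_value_cong_inj[OF inj R(1)] c by (simp add: numeral_eq_Suc)
  have yx: "?y \<otimes>\<^bsub>G\<^esub> ?x = inv\<^bsub>G\<^esub> ?x \<otimes>\<^bsub>G\<^esub> inv\<^bsub>G\<^esub> ?y"
    using word_value_cong_inj[OF inj R(2)] c by simp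
  have "inv\<^bsub>G\<^esub> ?y \<otimes>\<^bsub>G\<^esub> ?x = inv\<^bsub>G\<^esub> ?x \<otimes>\<^bsub>G\<^esub> ?y"
    using word_value_cong_inj[OF inj R(3)] c by simp
  \<comment> \<open>Multiply the preceding equation by \<open>?y\<close> on the left and by its
    inverse on the right.\<close>
  then have xy: "?y \<otimes>\<^bsub>G\<^esub> inv\<^bsub>G\<^esub> ?x = ?x \<otimes>\<^bsub>G\<^esub> inv\<^bsub>G\<^esub> ?y"
    using c by (metis G.inv_closed G.inv_solve_left G.inv_solve_right G.m_assoc G.m_closed)
  have yy: "inv\<^bsub>G\<^esub> ?y \<otimes>\<^bsub>G\<^esub> inv\<^bsub>G\<^esub> ?y = ?y \<otimes>\<^bsub>G\<^esub> ?y"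
    using yyyy c by (metis G.inv_equality G.inv_mult_group G.m_assoc G.m_closed)
  have "?y \<otimes>\<^bsub>G\<^esub> ?y \<otimes>\<^bsub>G\<^esub> ?x = ?y \<otimes>\<^bsub>G\<^esub> inv\<^bsub>G\<^esub> ?x \<otimes>\<^bsub>G\<^esub> inv\<^bsub>G\<^esub> ?y"
    using c by (simp add: G.m_assoc yx)
  then have comm: "?y \<otimes>\<^bsub>G\<^esub> ?y \<otimes>\<^bsub>G\<^esub> ?x = ?x \<otimes>\<^bsub>G\<^esub> (?y \<otimes>\<^bsub>G\<^esub> ?y)"
    using c by (simp add: G.m_assoc xy yy)
  have "?y \<otimes>\<^bsub>G\<^esub> ?x \<otimes>\<^bsub>G\<^esub> inv\<^bsub>G\<^esub> ?y = inv\<^bsub>G\<^esub> ?x \<otimes>\<^bsub>G\<^esub> (?y \<otimes>\<^bsub>G\<^esub> ?y)"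
    using c by (simp add: G.m_assoc yx yy)
  then have conj: "?y \<otimes>\<^bsub>G\<^esub> ?x \<otimes>\<^bsub>G\<^esub> inv\<^bsub>G\<^esub> ?y \<in> generate G ({?x, ?y \<otimes>\<^bsub>G\<^esub> ?y} \<union> group_center G)"
    by (simp add: generate.eng generate.inv generate.incl)
  show ?thesis
    by (rule G.commuting_transitive_if_two_generators[OF c carrier_eq_generate_two[OF UNIV_xy(1)] comm conj])
qed

subsection \<open>Integrality\<close>

theorem theorem3p1:
  fixes G :: "('a, 'b) monoid_scheme"
  assumes "group G"
    and "finite (carrier G)"
    and "\<not> comm_group G"
    and "(\<exists>p::nat. Factorial_Ring.prime p \<and>
            G Mod group_center G \<cong> integer_mod_group p \<times>\<times> integer_mod_group p)
       \<or> (\<exists>n\<ge>3. G Mod group_center G \<cong> D2n n)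
       \<or> ((\<exists>n\<ge>3. G \<cong> D2n n)
          \<or> (\<exists>n\<ge>2. G \<cong> T4n n)
          \<or> (\<exists>n\<ge>2. G \<cong> U6n n)
          \<or> (\<exists>n\<ge>2. \<exists>m\<ge>2. G \<cong> Unm n m)
          \<or> (\<exists>n\<ge>2. G \<cong> SD8n n)
          \<or> (\<exists>n\<ge>2. G \<cong> V8n n))"
  shows "CNL_integral (ccc_graph G) \<and> CNSL_integral (ccc_graph G)"
proof -
  interpret group G by fact
  have "commuting_transitive G"
    using assms(4)
  proof (elim disjE exE conjE)
    fix p :: nat assume p: "Factorial_Ring.prime p"
      and iso: "G Mod group_center G \<cong> integer_mod_group p \<times>\<times> integer_mod_group p"
    \<comment> \<open>Positivity of \<open>p\<close> matters, since
      \<open>integer_mod_group 0\<close> is the infinite group of integers.\<close>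
    have "card (carrier (integer_mod_group p)) = p"
      using prime_gt_0_nat[OF p] by (simp add: carrier_integer_mod_group)
    then have "card (carrier (G Mod group_center G)) = p * p"
      using iso_same_card[OF iso] by (simp add: DirProd_def card_cartesian_product)
    then show ?thesis
      using commuting_transitive_if_center_index_prime_square[OF assms(2) p] by blast
  next
    fix n assume "G Mod group_center G \<cong> D2n n"
    then show ?thesis
      unfolding D2n_def by (rule commuting_transitive_if_generator_inverted[OF assms(1) disjI2 UNIV_xy(1)]) simp
  next
    fix n assume "G \<cong> D2n n"
    then show ?thesis
      unfolding D2n_def by (rule commuting_transitive_if_generator_inverted[OF assms(1) disjI1 UNIV_xy(1)]) simp
  next
    fix n assume "G \<cong> T4n n"
    then show ?thesis
      unfolding T4n_def by (rule commuting_transitive_if_generator_inverted[OF assms(1) disjI1 UNIV_xy(1)]) simp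
  next
    \<comment> \<open>Here conjugation by \<open>X\<close> inverts \<open>Y\<close>, so the
      generators swap roles.\<close>
    fix n assume "G \<cong> U6n n"
    then show ?thesis
      unfolding U6n_def by (rule commuting_transitive_if_generator_inverted[OF assms(1) disjI1 UNIV_xy(2)]) simp
  next
    fix n m assume "G \<cong> Unm n m"
    then show ?thesis
      unfolding Unm_def by (rule commuting_transitive_if_generator_inverted[OF assms(1) disjI1 UNIV_xy(2)]) simp
  next
    fix n assume "G \<cong> SD8n n"
    then show ?thesis
      unfolding SD8n_def
      by (rule commuting_transitive_if_involution_conjugates_to_power[OF assms(1), where m = "2 * n - 1"]) simp_all
  next
    fix n assume "G \<cong> V8n n"
    then show ?thesis
      unfolding V8n_def by (rule commuting_transitive_V8n[OF assms(1)]) simp_all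
  qed
  then show ?thesis
    using pair_graph.CNL_CNSL_integral[OF pair_graph_ccc_graph[OF assms(2)]] ccc_graph_arcs_trans
    by blast
qed

end
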